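(* Let $n\ge1$ and let $\Sigma$ be a rotationally symmetric hypersurface in $H_n$ with generating curve $(x,t)$, $x>0$, in the $x_nt$-plane, parametrized by the horizontal arc-length $\tilde s$ of its horizontal generating curve, with angle function $\theta$. Then $$\frac{dx}{d\tilde s}=\alpha x,\qquad \frac{dt}{d\tilde s}=-kx^2\ \ \left(\text{equivalently } \frac{d\theta}{d\tilde s}=k\right),\qquad l=k+\left(\alpha\frac{dk}{d\tilde s}-k\frac{d\alpha}{d\tilde s}\right)x^2 .$$
   Context: The Heisenberg group $H_n$ is $\mathbb R^{2n+1}$ with coordinates $(x_1,\dots,x_n,y_1,\dots,y_n,t)$, $z=(x_1+iy_1,\dots,x_n+iy_n)$, contact form $\Theta=dt+\sum_{j}(x_jdy_j-y_jdx_j)$, contact bundle $\xi=\ker\Theta$, and left-invariant fields $\mathring e_\beta=\partial_{x_\beta}+y_\beta\partial_t$, $\mathring e_{n+\beta}=\partial_{y_\beta}-x_\beta\partial_t$, $T=\partial_t$. $J\mathring e_\beta=\mathring e_{n+\beta}$, $J\mathring e_{n+\beta}=-\mathring e_\beta$; the Levi metric $G$ on $\xi$ makes $\mathring e_1,\dots,\mathring e_{2n}$ orthonormal; $\nabla$ is the flat connection for which all $\mathring e_a$ and $T$ are parallel. $U(n)$ acts by $(z,t)\mapsto(Az,t)$. A rotationally symmetric hypersurface is one invariant under $U(n)$, generated by a smooth regular curve $(x(s),t(s))$, $x>0$, in the $x_nt$-plane: $\Sigma=\{(z,t):(|z|,t)=(x(s),t(s))\text{ for some }s\}$. The horizontal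 generating curve is $\tilde\gamma(s)=(0,\dots,0,x\cos\theta(s),0,\dots,0,x\sin\theta(s),t(s))$ (in the $x_ny_nt$-space), where the angle function $\theta$ satisfies $\theta'=-t'/x^2$, so that $\tilde\gamma'\in\xi$. The horizontal arc-length $\tilde s$ is given by $\frac{ds}{d\tilde s}=\frac{x}{\sqrt{(xx')^2+(t')^2}}$, i.e. it is the parameter for which $|\tilde\gamma'|_G=1$. Invariants. Let $\xi'=(\xi\cap T\Sigma)\cap J(\xi\cap T\Sigma)$, let $e_n\in\xi\cap T\Sigma$ be the unit vector $G$-orthogonal to $\xi'$ with orientation given by $\tilde\gamma'$ (extended by rotation), and $e_{2n}=Je_n$. Define $\alpha$ by $\alpha e_{2n}+T\in T\Sigma$ and $l$ by $-\nabla_{e_n}e_{2n}=l\,e_n$. For $n\ge2$, $k$ is the common eigenvalue on $\xi'$ of $v\mapsto-\nabla_ve_{2n}+\alpha Jv$ (it exists for rotationally symmetric hypersurfaces); for $n=1$, $k$ is defined by the formula valid for $n\ge2$, $k=\frac{-t'}{x\sqrt{(xx')^2+(t')^2}}$ (prime is derivative in an arbitrary parameter compatible with the orientation). By symmetry $\alpha,k,l$ are functions of $\tilde s$. *)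

theory Defs
  imports "HOL-Analysis.Analysis"
begin

text \<open>
  With $n$ the cardinality of the index type, the Heisenberg group $H_n$ is the real vector space
  of pairs $(z,t)$ with $z_j = x_j + i y_j$.  Tangent vectors at a point are elements of the same
  type, written in the coordinate basis $\partial_{x_j}, \partial_{y_j}, \partial_t$.
\<close>

type_synonym 'n heis = "(complex ^ 'n) \<times> real"

definition contact_form :: "'n::finite heis \<Rightarrow> 'n heis \<Rightarrow> real" where
  "contact_form p v =
     snd v + (\<Sum>j\<in>UNIV. Re (fst p $ j) * Im (fst v $ j) - Im (fst p $ j) * Re (fst v $ j))"

definition contact_bundle :: "'n::finite heis \<Rightarrow> 'n heis set" where
  "contact_bundle p = {v. contact_form p v = 0}"

definition frame_x :: "'n::finite \<Rightarrow> 'n heis \<Rightarrow> 'n heis" where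
  "frame_x b p = (axis b 1, Im (fst p $ b))"

definition frame_y :: "'n::finite \<Rightarrow> 'n heis \<Rightarrow> 'n heis" where
  "frame_y b p = (axis b \<i>, - Re (fst p $ b))"

definition reeb :: "'n::finite heis" where
  "reeb = (0, 1)"

definition from_frame :: "'n::finite heis \<Rightarrow> 'n heis \<Rightarrow> 'n heis" where
  "from_frame p c =
     (\<Sum>b\<in>UNIV. Re (fst c $ b) *\<^sub>R frame_x b p + Im (fst c $ b) *\<^sub>R frame_y b p) + snd c *\<^sub>R reeb"

text \<open>
  The components of a tangent vector in the left-invariant frame, packed as a pair: the real and
  imaginary parts of the first entry belong to the horizontal fields, the second entry to $T$.
\<close>

definition to_frame :: "'n::finite heis \<Rightarrow> 'n heis \<Rightarrow> 'n heis" where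
  "to_frame p v = (fst v, contact_form p v)"

lemma from_frame_eq:
  "from_frame p c =
     (fst c, snd c + (\<Sum>b\<in>UNIV. Re (fst c $ b) * Im (fst p $ b) - Im (fst c $ b) * Re (fst p $ b)))"
proof -
  have 1: "fst (from_frame p c) $ j = fst c $ j" for j
  proof -
    have "fst (from_frame p c) $ j =
        (\<Sum>b\<in>UNIV. Re (fst c $ b) *\<^sub>R (if j = b then 1 else 0) +
                   Im (fst c $ b) *\<^sub>R (if j = b then \<i> else 0))"
      by (simp add: from_frame_def frame_x_def frame_y_def reeb_def fst_sum axis_def)
    also have "\<dots> = (\<Sum>b\<in>UNIV. if j = b then fst c $ b else 0)"
      by (rule sum.cong) (auto simp: complex_eq_iff)
    also have "\<dots> = fst c $ j"
      by simp
    finally show ?thesis .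
  qed
  have 2: "snd (from_frame p c) =
      snd c + (\<Sum>b\<in>UNIV. Re (fst c $ b) * Im (fst p $ b) - Im (fst c $ b) * Re (fst p $ b))"
    by (simp add: from_frame_def frame_x_def frame_y_def reeb_def snd_sum)
  show ?thesis
    by (rule prod_eqI) (simp_all add: vec_eq_iff 1 2)
qed

lemma from_frame_to_frame: "from_frame p (to_frame p v) = v"
proof -
  have "(\<Sum>j\<in>UNIV. Re (fst p $ j) * Im (fst v $ j) - Im (fst p $ j) * Re (fst v $ j)) =
      - (\<Sum>b\<in>UNIV. Re (fst v $ b) * Im (fst p $ b) - Im (fst v $ b) * Re (fst p $ b))"
    by (subst sum_negf [symmetric], rule sum.cong) (auto simp: mult.commute)
  then show ?thesis
    by (simp add: from_frame_eq to_frame_def contact_form_def)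
qed

lemma to_frame_from_frame: "to_frame p (from_frame p c) = c"
proof -
  have "(\<Sum>j\<in>UNIV. Re (fst p $ j) * Im (fst c $ j) - Im (fst p $ j) * Re (fst c $ j)) =
      - (\<Sum>b\<in>UNIV. Re (fst c $ b) * Im (fst p $ b) - Im (fst c $ b) * Re (fst p $ b))"
    by (subst sum_negf [symmetric], rule sum.cong) (auto simp: mult.commute)
  then show ?thesis
    by (simp add: from_frame_eq to_frame_def contact_form_def)
qed

definition cplx_str :: "'n::finite heis \<Rightarrow> 'n heis \<Rightarrow> 'n heis" where
  "cplx_str p v =
     (\<Sum>b\<in>UNIV. Re (fst v $ b) *\<^sub>R frame_y b p - Im (fst v $ b) *\<^sub>R frame_x b p)"

text \<open>
  By \<open>from_frame_to_frame\<close> the frame components of a horizontal vector are the real and imaginary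
  parts of its first entry, so the metric making the frame orthonormal is the real inner product
  of the first entries.
\<close>

definition levi_metric :: "'n::finite heis \<Rightarrow> 'n heis \<Rightarrow> real" where
  "levi_metric u v = fst u \<bullet> fst v"

lemma levi_metric_frame:
  "levi_metric (frame_x a p) (frame_x b p) = (if a = b then 1 else 0)"
  "levi_metric (frame_y a p) (frame_y b p) = (if a = b then 1 else 0)"
  "levi_metric (frame_x a p) (frame_y b p) = 0"
  by (auto simp: levi_metric_def frame_x_def frame_y_def inner_axis_axis inner_complex_def)

lemma contact_bundle_frame: "frame_x b p \<in> contact_bundle p" "frame_y b p \<in> contact_bundle p"
  by (simp_all add: contact_bundle_def contact_form_def frame_x_def frame_y_def axis_def
      if_distrib if_distribR cong: if_cong)

lemma cplx_str_frame:
  "cplx_str p (frame_x a p) = frame_y a p"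
  "cplx_str p (frame_y a p) = - frame_x a p"
proof -
  have "cplx_str p (frame_x a p) = (\<Sum>b\<in>UNIV. if b = a then frame_y b p else 0)"
    unfolding cplx_str_def by (rule sum.cong) (auto simp: frame_x_def axis_def zero_prod_def)
  then show "cplx_str p (frame_x a p) = frame_y a p" by simp
  have "cplx_str p (frame_y a p) = (\<Sum>b\<in>UNIV. if b = a then - frame_x b p else 0)"
    unfolding cplx_str_def by (rule sum.cong) (auto simp: frame_y_def frame_x_def axis_def zero_prod_def)
  then show "cplx_str p (frame_y a p) = - frame_x a p" by simp
qed

text \<open>
  \<open>has_flat_deriv S X p v w\<close>: the vector field \<open>X\<close> along \<open>S\<close> is differentiable at \<open>p\<close> and
  $\nabla_v X = w$ there, for the connection with parallel left-invariant frame, i.e. the frame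
  components of \<open>X\<close> are differentiated in the direction \<open>v\<close>.  Only the values of \<open>X\<close> on \<open>S\<close> matter;
  the derivative within \<open>S\<close> is determined on vectors tangent to \<open>S\<close>, the only ones it is used for.
\<close>

definition has_flat_deriv ::
    "'n::finite heis set \<Rightarrow> ('n heis \<Rightarrow> 'n heis) \<Rightarrow> 'n heis \<Rightarrow> 'n heis \<Rightarrow> 'n heis \<Rightarrow> bool" where
  "has_flat_deriv S X p v w \<longleftrightarrow>
     (\<exists>D. ((\<lambda>q. to_frame q (X q)) has_derivative D) (at p within S) \<and> w = from_frame p (D v))"

primrec Ck_on :: "nat \<Rightarrow> 'a set \<Rightarrow> ('a::euclidean_space \<Rightarrow> 'b::real_normed_vector) \<Rightarrow> bool" where
  "Ck_on 0 S f \<longleftrightarrow> continuous_on S f"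
| "Ck_on (Suc k) S f \<longleftrightarrow>
     (\<exists>f'. (\<forall>x\<in>S. (f has_derivative f' x) (at x)) \<and> (\<forall>v. Ck_on k S (\<lambda>x. f' x v)))"

text \<open>Infinite differentiability, for open \<open>S\<close>.\<close>

definition smooth_on :: "'a set \<Rightarrow> ('a::euclidean_space \<Rightarrow> 'b::real_normed_vector) \<Rightarrow> bool" where
  "smooth_on S f \<longleftrightarrow> (\<forall>k. Ck_on k S f)"

text \<open>
  Locally a regular level set.  Restricting a generating curve to short parameter intervals puts
  immersed hypersurfaces in this form.
\<close>

definition smooth_hypersurface :: "'n::finite heis set \<Rightarrow> bool" where
  "smooth_hypersurface S \<longleftrightarrow>
     (\<forall>p\<in>S. \<exists>U (F :: 'n heis \<Rightarrow> real) F'. open U \<and> p \<in> U \<and> smooth_on U F \<and>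
        (\<forall>q\<in>U. (F has_derivative F' q) (at q) \<and> F' q \<noteq> (\<lambda>_. 0)) \<and>
        S \<inter> U = {q \<in> U. F q = 0})"

definition tangent_space :: "'n::finite heis set \<Rightarrow> 'n heis \<Rightarrow> 'n heis set" where
  "tangent_space S p =
     {v. \<exists>c. (\<forall>r. c r \<in> S) \<and> c 0 = p \<and> (c has_vector_derivative v) (at (0::real))}"

definition unitary_matrix :: "complex ^ 'n ^ 'n \<Rightarrow> bool" where
  "unitary_matrix A \<longleftrightarrow> (\<chi> i j. cnj (A $ j $ i)) ** A = mat 1"

text \<open>This map is linear, hence it is also its own differential.\<close>

definition rot :: "complex ^ 'n ^ 'n \<Rightarrow> 'n::finite heis \<Rightarrow> 'n heis" where
  "rot A p = (A *v fst p, snd p)"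

definition rotationally_symmetric :: "'n::finite heis set \<Rightarrow> bool" where
  "rotationally_symmetric S \<longleftrightarrow> (\<forall>A. unitary_matrix A \<longrightarrow> rot A ` S = S)"

definition regular_curve :: "real set \<Rightarrow> (real \<Rightarrow> real) \<Rightarrow> (real \<Rightarrow> real) \<Rightarrow> bool" where
  "regular_curve I x t \<longleftrightarrow>
     smooth_on I x \<and> smooth_on I t \<and> (\<forall>s\<in>I. (deriv x s, deriv t s) \<noteq> (0, 0))"

definition generated_set :: "real set \<Rightarrow> (real \<Rightarrow> real) \<Rightarrow> (real \<Rightarrow> real) \<Rightarrow> 'n::finite heis set" where
  "generated_set I x t = {(z, \<tau>). \<exists>s\<in>I. norm z = x s \<and> \<tau> = t s}"

text \<open>
  The index \<open>m\<close> plays the role of the distinguished last coordinate; a finite index type has no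
  preferred element.
\<close>

definition horizontal_curve ::
    "'n \<Rightarrow> (real \<Rightarrow> real) \<Rightarrow> (real \<Rightarrow> real) \<Rightarrow> (real \<Rightarrow> real) \<Rightarrow> real \<Rightarrow> 'n::finite heis" where
  "horizontal_curve m x \<theta> t s = (axis m (Complex (x s * cos (\<theta> s)) (x s * sin (\<theta> s))), t s)"

definition horizontal_tangent :: "'n::finite heis set \<Rightarrow> 'n heis \<Rightarrow> 'n heis set" where
  "horizontal_tangent S p = contact_bundle p \<inter> tangent_space S p"

definition complex_tangent :: "'n::finite heis set \<Rightarrow> 'n heis \<Rightarrow> 'n heis set" where
  "complex_tangent S p = horizontal_tangent S p \<inter> cplx_str p ` horizontal_tangent S p"

text \<open>
  The field $e_n$ along \<open>S\<close>.  The last clause fixes its sign along the horizontal curve \<open>g\<close> by $g'$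
  and along the rotated copies of \<open>g\<close> by rotating $g'$.
\<close>

definition is_e_n ::
    "'n::finite heis set \<Rightarrow> real set \<Rightarrow> (real \<Rightarrow> 'n heis) \<Rightarrow> ('n heis \<Rightarrow> 'n heis) \<Rightarrow> bool" where
  "is_e_n S I g E \<longleftrightarrow>
     (\<forall>p\<in>S. E p \<in> horizontal_tangent S p \<and> levi_metric (E p) (E p) = 1 \<and>
        (\<forall>v\<in>complex_tangent S p. levi_metric (E p) v = 0)) \<and>
     (\<forall>s\<in>I. \<forall>A. unitary_matrix A \<longrightarrow>
        levi_metric (E (rot A (g s))) (rot A (vector_derivative g (at s))) > 0)"

definition e_2n :: "('n::finite heis \<Rightarrow> 'n heis) \<Rightarrow> 'n heis \<Rightarrow> 'n heis" where
  "e_2n E p = cplx_str p (E p)"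

definition is_alpha :: "'n::finite heis set \<Rightarrow> ('n heis \<Rightarrow> 'n heis) \<Rightarrow> 'n heis \<Rightarrow> real \<Rightarrow> bool" where
  "is_alpha S E p a \<longleftrightarrow> a *\<^sub>R e_2n E p + reeb \<in> tangent_space S p"

definition is_l :: "'n::finite heis set \<Rightarrow> ('n heis \<Rightarrow> 'n heis) \<Rightarrow> 'n heis \<Rightarrow> real \<Rightarrow> bool" where
  "is_l S E p l \<longleftrightarrow> (\<exists>w. has_flat_deriv S (e_2n E) p (E p) w \<and> - w = l *\<^sub>R E p)"

definition is_common_eigenvalue ::
    "'n::finite heis set \<Rightarrow> ('n heis \<Rightarrow> 'n heis) \<Rightarrow> 'n heis \<Rightarrow> real \<Rightarrow> real \<Rightarrow> bool" where
  "is_common_eigenvalue S E p a k \<longleftrightarrow>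
     (\<forall>v\<in>complex_tangent S p.
        \<exists>w. has_flat_deriv S (e_2n E) p v w \<and> - w + a *\<^sub>R cplx_str p v = k *\<^sub>R v)"

end

theory Submission
  imports Defs
begin

text \<open>
  A point of $\Sigma$ has the form $p = (x e, t)$ with $|e| = 1$, where $x$ and $t$ are taken at
  some parameter $s$.  The tangent space is the kernel of the differential of a local defining
  function.  It contains $(w,0)$ for every $w$ orthogonal to $e$, because the sphere of radius
  $x$ at height $t$ lies in $\Sigma$, and the meridian direction $(x'e, t')$.  Counting dimensions,
  a tangent vector $v$ satisfies $t' \langle v_z, e \rangle = x' v_t$ (\<open>tangent_meridian\<close>).  Put
  $\eta = x' - i t'/x = x' + i x \theta'$; horizontal arc-length means $|\eta| = 1$.

  \<^item> A horizontal vector has $v_t = -x \langle v_z, ie \rangle$.  Together with the equation above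
  this forces $v_z \in \mathbb R\,\eta e$ modulo the complex orthogonal complement of $e$, which is
  $\xi'$.  So $e_n$ has first component $\pm\eta e$, and the orientation selects the plus sign
  (\<open>e_n_eq\<close>).  Along the horizontal curve this is its velocity.
  \<^item> Substituting $\alpha e_{2n} + T$ in the equation of the tangent space gives
  $\alpha x = x'$ (\<open>alpha_eq\<close>).
  \<^item> If $n \ge 2$, turn $e$ towards a second coordinate axis by a curve of unitary matrices.  The
  direction of this motion lies in $\xi'$, and $e_{2n}$ turns along, so its derivative is read
  off and gives $kx = \mathrm{Im}\,\eta$, that is $k = \theta'$ (\<open>k_eq\<close>).  For $n = 1$ the
  defining formula of $k$ is $\theta'$ in arc-length parametrization.
  \<^item> Along the horizontal curve $e_{2n} = i\eta e^{i\theta}$ in the frame, and differentiating it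
  gives $l = \theta' + \mathrm{Im}(\bar\eta\,\eta')$ (\<open>l_eq\<close>): the curvature of the projected
  plane curve.

  Finally $\eta = (\alpha + i k) x$ by the second and third items, and expanding
  $\mathrm{Im}(\bar\eta\,\eta')$ in this form cancels all terms with $x'$ and leaves
  $(\alpha k' - k \alpha') x^2$.
\<close>

section \<open>Linear algebra of the frame\<close>

lemma inner_i_left: "(\<i> *s u) \<bullet> v = - (u \<bullet> (\<i> *s (v::complex^'n::finite)))"
  by (simp add: inner_vec_def inner_complex_def vector_scalar_mult_def flip: sum_negf)

lemma inner_i_i: "(\<i> *s u) \<bullet> (\<i> *s v) = u \<bullet> (v::complex^'n::finite)"
  by (simp add: inner_vec_def inner_complex_def vector_scalar_mult_def add.commute)

lemma inner_i_self: "u \<bullet> (\<i> *s u) = 0" "(\<i> *s u) \<bullet> (u::complex^'n::finite) = 0"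
  by (simp_all add: inner_vec_def inner_complex_def vector_scalar_mult_def mult.commute)

lemma complex_scale_eq:
  "c *s u = Re c *\<^sub>R u + Im c *\<^sub>R (\<i> *s (u::complex^'n::finite))"
  by (simp add: vec_eq_iff vector_scalar_mult_def complex_eq_iff)

lemma scale_scaleR: "c *s (r *\<^sub>R u) = r *\<^sub>R (c *s (u::complex^'n::finite))"
  by (simp add: vec_eq_iff vector_scalar_mult_def)

lemma scaleR_eq_scale: "r *\<^sub>R u = complex_of_real r *s (u::complex^'n::finite)"
  by (simp add: vec_eq_iff vector_scalar_mult_def complex_eq_iff)

lemma inner_scale_unit: "norm e = 1 \<Longrightarrow> (c *s e) \<bullet> e = Re c" for e :: "complex^'n::finite"
  by (simp add: complex_scale_eq[of c] inner_add_left inner_i_self dot_square_norm)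

lemma contact_form_inner: "contact_form p v = snd v + (\<i> *s fst p) \<bullet> fst v"
  by (simp add: contact_form_def inner_vec_def inner_complex_def vector_scalar_mult_def
      algebra_simps)

lemma cplx_str_eq: "cplx_str p v = (\<i> *s fst v, - (fst v \<bullet> fst p))"
proof -
  have "cplx_str p v = from_frame p (\<i> *s fst v, 0)"
    unfolding cplx_str_def from_frame_def
    by (simp add: vector_scalar_mult_def add.commute)
  also have "\<dots> = (\<i> *s fst v, - (fst v \<bullet> fst p))"
    by (simp add: from_frame_eq inner_vec_def inner_complex_def vector_scalar_mult_def
        algebra_simps flip: sum_negf)
  finally show ?thesis .
qed

lemma to_frame_cplx_str: "to_frame p (cplx_str p v) = (\<i> *s fst v, 0)"
  by (simp add: to_frame_def contact_form_inner cplx_str_eq inner_i_i inner_commute)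

lemma bounded_linear_axis: "bounded_linear (axis m :: complex \<Rightarrow> complex^'n::finite)"
  unfolding linear_conv_bounded_linear[symmetric]
  by (intro linearI) (auto simp: axis_def vec_eq_iff)

lemma scale_axis: "c *s axis m d = axis m (c * d)" for c d :: complex
  by (auto simp: vec_eq_iff axis_def)

section \<open>Tangent vectors\<close>

text \<open>
  Curves that leave $S$ away from time zero are allowed: they are replaced by the constant $p$
  there, which does not affect the derivative.
\<close>

lemma tangent_spaceI:
  assumes c: "(c has_vector_derivative v) (at (0::real))" and "c 0 = p" "p \<in> S"
    and ev: "\<forall>\<^sub>F r in nhds 0. c r \<in> S"
  shows "v \<in> tangent_space S p"
proof -
  let ?c = "\<lambda>r. if c r \<in> S then c r else p"
  obtain U where U: "open U" "0 \<in> U" "\<And>r. r \<in> U \<Longrightarrow> c r \<in> S"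
    using ev by (auto simp: eventually_nhds)
  have "(?c has_vector_derivative v) (at 0)"
    by (rule has_vector_derivative_transform_within_open[OF c U(1,2)]) (simp add: U(3))
  then show ?thesis
    unfolding tangent_space_def using assms by (auto intro!: exI[of _ ?c])
qed

lemma tangent_space_level_set:
  assumes v: "v \<in> tangent_space S p" and U: "open U" "p \<in> U"
    and F: "(F has_derivative F') (at p)" and SU: "S \<inter> U = {q \<in> U. F q = (0::real)}"
  shows "F' v = 0"
proof -
  obtain c where c: "\<And>r. c r \<in> S" "c 0 = p" "(c has_vector_derivative v) (at (0::real))"
    using v by (auto simp: tangent_space_def)
  have cont: "isCont c 0"
    using c(3) by (rule has_vector_derivative_continuous)
  obtain V where V: "open V" "0 \<in> V" "\<And>r. r \<in> V \<Longrightarrow> c r \<in> U"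
    using cont U c(2) unfolding continuous_at_open by metis
  have F0: "F (c r) = 0" if "r \<in> V" for r
    using SU c(1)[of r] V(3)[OF that] by blast
  have "((\<lambda>r. F (c r)) has_derivative (\<lambda>r. F' (r *\<^sub>R v))) (at 0)"
    using has_derivative_compose[of c "\<lambda>r. r *\<^sub>R v" 0 UNIV F F'] c F
    by (simp add: has_vector_derivative_def)
  then have "((\<lambda>_. 0) has_derivative (\<lambda>r. F' (r *\<^sub>R v))) (at (0::real))"
    by (rule has_derivative_transform_within_open[OF _ V(1,2)]) (simp add: F0)
  then have "(\<lambda>r::real. F' (r *\<^sub>R v)) = (\<lambda>_. 0)"
    by (rule has_derivative_unique) (rule has_derivative_const)
  then show ?thesis
    by (auto dest: fun_cong[of _ _ 1])
qed

text \<open>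
  The chain rule: it computes $\nabla_v X$ as the derivative of the frame components of $X$ along
  any curve in $S$ with velocity $v$, so that $X$ need be known only on that curve.
\<close>

lemma has_flat_deriv_along_curve:
  assumes D: "has_flat_deriv S X p v w" and J: "open J" "s \<in> J" "c ` J \<subseteq> S" "c s = p"
    and c: "(c has_vector_derivative v) (at s)"
    and d: "((\<lambda>r. to_frame (c r) (X (c r))) has_vector_derivative d) (at s)"
  shows "fst w = fst d"
proof -
  obtain D where D: "((\<lambda>q. to_frame q (X q)) has_derivative D) (at p within S)"
    and w: "w = from_frame p (D v)"
    using D by (auto simp: has_flat_deriv_def)
  have "((\<lambda>q. to_frame q (X q)) has_derivative D) (at (c s) within c ` J)"
    using D J by (auto intro: has_derivative_subset)
  moreover have "(c has_derivative (\<lambda>r. r *\<^sub>R v)) (at s within J)"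
    using c by (auto simp: has_vector_derivative_def intro: has_derivative_at_withinI)
  ultimately have "((\<lambda>r. to_frame (c r) (X (c r))) has_derivative (\<lambda>r. D (r *\<^sub>R v))) (at s within J)"
    by (rule has_derivative_in_compose[of c "\<lambda>r. r *\<^sub>R v" s J, rotated])
  then have "((\<lambda>r. to_frame (c r) (X (c r))) has_derivative (\<lambda>r. D (r *\<^sub>R v))) (at s)"
    unfolding at_within_open[OF J(2,1)] .
  then have "(\<lambda>r. D (r *\<^sub>R v)) = (\<lambda>r. r *\<^sub>R d)"
    using d[unfolded has_vector_derivative_def] by (rule has_derivative_unique)
  then have "D v = d"
    by (auto dest: fun_cong[of _ _ 1])
  then show ?thesis
    by (simp add: w from_frame_eq)
qed

section \<open>Unitary matrices and derivatives of smooth functions\<close>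

text \<open>
  A Householder reflection $1 - 2uu^T$ serves as well as a rotation, since only the image of one
  axis matters, and its unitarity follows from $|u| = 1$ alone.
\<close>

lemma exists_unitary_rotation:
  fixes m j :: "'n::finite" and r :: real
  assumes "m \<noteq> j"
  obtains A :: "complex^'n^'n" where "unitary_matrix A"
    "\<And>d :: complex. A *v axis m d = axis m (cos r * d) + axis j (sin r * d)"
proof -
  define u :: "'n \<Rightarrow> real" where
    "u a = (if a = m then - sin (r/2) else if a = j then cos (r/2) else 0)" for a
  define A :: "complex^'n^'n" where
    "A = (\<chi> a b. (if a = b then 1 else 0) - 2 * u a * u b)"
  have "(\<Sum>a\<in>UNIV. (u a)\<^sup>2) =
      (\<Sum>a\<in>UNIV. (if a = m then (sin (r/2))\<^sup>2 else 0) + (if a = j then (cos (r/2))\<^sup>2 else 0))"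
    by (rule sum.cong) (auto simp: u_def assms)
  then have uu: "(\<Sum>a\<in>UNIV. (u a)\<^sup>2) = 1"
    by (simp add: sum.distrib)
  have "(\<Sum>c\<in>UNIV. cnj (A $ c $ a) * A $ c $ b) = (if a = b then 1 else 0)" for a b
  proof -
    have "(\<Sum>c\<in>UNIV. cnj (A $ c $ a) * A $ c $ b) =
      (\<Sum>c\<in>UNIV. (if c = a then complex_of_real ((if a = b then 1 else 0) - 2 * u a * u b) else 0)
        + (if c = b then complex_of_real (- 2 * (u a * u b)) else 0)
        + complex_of_real (4 * u a * u b) * complex_of_real ((u c)\<^sup>2))"
      by (rule sum.cong) (auto simp: A_def algebra_simps power2_eq_square)
    also have "\<dots> = complex_of_real ((if a = b then 1 else 0) - 2 * u a * u b)
        + complex_of_real (- 2 * (u a * u b))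
        + complex_of_real (4 * u a * u b) * complex_of_real (\<Sum>c\<in>UNIV. (u c)\<^sup>2)"
      by (simp add: sum.distrib flip: sum_distrib_left)
    finally show ?thesis by (simp add: uu)
  qed
  then have "unitary_matrix A"
    by (auto simp: unitary_matrix_def matrix_matrix_mult_def mat_def vec_eq_iff)
  moreover have "A *v axis m d = axis m (cos r * d) + axis j (sin r * d)" for d :: complex
  proof -
    have *: "cos r = 1 - 2 * (sin (r/2))\<^sup>2" "sin r = 2 * sin (r/2) * cos (r/2)"
      using cos_double_sin[of "r/2"] sin_double[of "r/2"] by simp_all
    have "(A *v axis m d) $ a = A $ a $ m * d" for a
      by (simp add: matrix_vector_mult_def axis_def if_distrib cong: if_cong)
    moreover have "A $ a $ m = (if a = m then cos r else 0) + (if a = j then sin r else 0)" for a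
      unfolding * using assms by (simp add: A_def u_def power2_eq_square)
    ultimately show ?thesis using assms
      by (simp add: vec_eq_iff axis_def)
  qed
  ultimately show thesis using that by blast
qed

lemma smooth_on_DERIV:
  assumes "smooth_on I f" "open I" "s \<in> I"
  shows "(f has_real_derivative deriv f s) (at s)"
    and "(deriv f has_real_derivative deriv (deriv f) s) (at s)"
proof -
  have "Ck_on (Suc (Suc 0)) I f" using assms(1) by (simp only: smooth_on_def)
  then obtain f' where f': "\<And>r. r \<in> I \<Longrightarrow> (f has_derivative f' r) (at r)"
    and f'': "\<And>v. Ck_on (Suc 0) I (\<lambda>r. f' r v)"
    by auto
  have *: "(f has_real_derivative f' r 1) (at r)" if "r \<in> I" for r
  proof (rule has_derivative_imp_has_field_derivative[OF f'[OF that]])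
    show "v * f' r 1 = f' r v" for v
      using linear_scale[OF has_derivative_linear[OF f'[OF that]], of v 1] by simp
  qed
  then have eq: "deriv f r = f' r 1" if "r \<in> I" for r
    using that DERIV_imp_deriv by blast
  show "(f has_real_derivative deriv f s) (at s)" using * eq assms by auto
  obtain f2 where "((\<lambda>r. f' r 1) has_derivative f2) (at s)"
    using f''[of 1] assms(3) by auto
  then have "(deriv f has_derivative f2) (at s)"
    by (rule has_derivative_transform_within_open[OF _ assms(2,3)]) (simp add: eq)
  then show "(deriv f has_real_derivative deriv (deriv f) s) (at s)"
    by (auto intro!: DERIV_deriv_iff_real_differentiable[THEN iffD2] simp: differentiable_def)
qed

lemma has_vector_derivative_axis:
  fixes f :: "real \<Rightarrow> complex"
  assumes "(f has_vector_derivative d) F"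
  shows "((\<lambda>r. axis m (f r) :: complex^'n::finite) has_vector_derivative axis m d) F"
  by (rule bounded_linear.has_vector_derivative[OF bounded_linear_axis assms])

section \<open>Rotationally symmetric hypersurfaces\<close>

locale rotational_hypersurface =
  fixes S :: "'n::finite heis set" and I :: "real set" and x t \<theta> :: "real \<Rightarrow> real"
    and m :: 'n and E :: "'n heis \<Rightarrow> 'n heis"
  assumes open_I: "open I"
    and curve: "regular_curve I x t" and pos: "s \<in> I \<Longrightarrow> x s > 0"
    and S_eq: "S = generated_set I x t" and hypersurface: "smooth_hypersurface S"
    and angle: "s \<in> I \<Longrightarrow> (\<theta> has_real_derivative - deriv t s / (x s)\<^sup>2) (at s)"
    and arc_length: "s \<in> I \<Longrightarrow>
      levi_metric (vector_derivative (horizontal_curve m x \<theta> t) (at s))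
        (vector_derivative (horizontal_curve m x \<theta> t) (at s)) = 1"
    and e_n: "is_e_n S I (horizontal_curve m x \<theta> t) E"
begin

abbreviation g :: "real \<Rightarrow> 'n heis" where
  "g \<equiv> horizontal_curve m x \<theta> t"

text \<open>
  The velocity of the horizontal curve, in the frame and in units of the current direction
  $e^{i\theta}$.  The imaginary part is $x \theta'$.
\<close>

definition \<eta> :: "real \<Rightarrow> complex" where
  "\<eta> s = Complex (deriv x s) (- deriv t s / x s)"

abbreviation point :: "real \<Rightarrow> complex^'n \<Rightarrow> 'n heis" where
  "point s e \<equiv> (x s *\<^sub>R e, t s)"

lemma derivatives:
  assumes "s \<in> I"
  shows "(x has_real_derivative deriv x s) (at s)"
    "(deriv x has_real_derivative deriv (deriv x) s) (at s)"
    "(t has_real_derivative deriv t s) (at s)"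
    "(deriv t has_real_derivative deriv (deriv t) s) (at s)"
  using curve smooth_on_DERIV open_I assms unfolding regular_curve_def by blast+

lemma point_in_S: "s \<in> I \<Longrightarrow> norm e = 1 \<Longrightarrow> point s e \<in> S"
  using pos[of s] by (auto simp: S_eq generated_set_def)

text \<open>
  The great circle of the sphere $|z| = x$ through $xe$ in direction $w$ has this velocity.  For
  $w = 0$ the circle degenerates to a point, as \<open>sgn 0 = 0\<close>.
\<close>

lemma sphere_tangent:
  assumes s: "s \<in> I" and e: "norm e = 1" and w: "w \<bullet> e = 0"
  shows "(w, 0) \<in> tangent_space S (point s e)"
proof (rule tangent_spaceI)
  define a where "a = norm w / x s"
  define u where "u r = cos (r * a) *\<^sub>R e + sin (r * a) *\<^sub>R sgn w" for r
  have "e \<bullet> e = 1" "w \<noteq> 0 \<Longrightarrow> sgn w \<bullet> sgn w = 1" "sgn w \<bullet> e = 0" "e \<bullet> sgn w = 0"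
    using e w norm_sgn[of w] by (simp_all add: dot_square_norm sgn_div_norm inner_commute)
  then have "norm (u r) = 1" for r
    by (cases "w = 0") (auto simp: norm_eq_1 u_def a_def inner_add inner_commute e
      simp flip: power2_eq_square)
  then show "\<forall>\<^sub>F r in nhds 0. point s (u r) \<in> S"
    using s by (simp add: point_in_S)
  show "point s e \<in> S" using s e by (rule point_in_S)
  show "point s (u 0) = point s e" by (simp add: u_def)
  have "((\<lambda>r. point s (u r)) has_vector_derivative ((x s * a) *\<^sub>R sgn w, 0)) (at 0)"
    unfolding u_def has_vector_derivative_def
    by (auto intro!: derivative_eq_intros simp: fun_eq_iff mult.commute)
  moreover have "(x s * a) *\<^sub>R sgn w = w"
    using pos[OF s] by (cases "w = 0") (simp_all add: a_def sgn_div_norm)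
  ultimately show "((\<lambda>r. point s (u r)) has_vector_derivative (w, 0)) (at 0)"
    by simp
qed

lemma meridian_tangent:
  assumes s: "s \<in> I" and e: "norm e = 1"
  shows "(deriv x s *\<^sub>R e, deriv t s) \<in> tangent_space S (point s e)"
proof (rule tangent_spaceI)
  show "point s e \<in> S" using s e by (rule point_in_S)
  show "point (s + 0) e = point s e" by simp
  have "\<forall>\<^sub>F r in nhds 0. s + r \<in> I"
    using eventually_nhds_in_open[OF open_vimage[OF open_I, of "\<lambda>r. s + r"], of 0] s
    by (simp add: continuous_intros)
  then show "\<forall>\<^sub>F r in nhds 0. point (s + r) e \<in> S"
    by (rule eventually_mono) (simp add: point_in_S e)
  have 1: "((\<lambda>r. x (s + r)) has_real_derivative deriv x s) (at 0)"
    "((\<lambda>r. t (s + r)) has_real_derivative deriv t s) (at 0)"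
    using derivatives[OF s] by (simp_all add: DERIV_shift[of _ _ 0 s, simplified] add.commute)
  then show "((\<lambda>r. point (s + r) e) has_vector_derivative (deriv x s *\<^sub>R e, deriv t s)) (at 0)"
    unfolding has_vector_derivative_def has_field_derivative_def
    by (auto intro!: derivative_eq_intros simp: fun_eq_iff mult.commute)
qed

text \<open>
  The differential $L$ of a defining function annihilates $(w,0)$ for $w \perp e$, so
  $L v = a \langle v_z, e \rangle + b v_t$ with $(a,b) \ne 0$.  Both $(x', t')$ and
  $(\langle v_z, e \rangle, v_t)$ are orthogonal to $(a,b)$ in the plane, hence their determinant
  vanishes.
\<close>

lemma tangent_meridian:
  assumes s: "s \<in> I" and e: "norm e = 1" and v: "v \<in> tangent_space S (point s e)"
  shows "deriv t s * (fst v \<bullet> e) = deriv x s * snd v"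
proof -
  let ?p = "point s e"
  obtain U F F' where U: "open U" "?p \<in> U"
    and F: "\<And>q. q \<in> U \<Longrightarrow> (F has_derivative F' q) (at q) \<and> F' q \<noteq> (\<lambda>_. 0)"
    and SU: "S \<inter> U = {q \<in> U. F q = (0::real)}"
    using bspec[OF hypersurface[unfolded smooth_hypersurface_def] point_in_S[OF s e]]
    by (elim exE conjE) (rule that, assumption+, blast, assumption)
  define L where "L = F' ?p"
  have L: "(F has_derivative L) (at ?p)" "L \<noteq> (\<lambda>_. 0)"
    using F[OF U(2)] by (auto simp: L_def)
  have ker: "L v = 0" if "v \<in> tangent_space S ?p" for v
    using tangent_space_level_set[OF that U L(1) SU] .
  have lin: "linear L" using L(1) by (rule has_derivative_linear)
  have ee: "e \<bullet> e = 1" using e by (simp add: dot_square_norm)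
  define a b where "a = L (e, 0)" and "b = L (0, 1)"
  have L_eq: "L v = (fst v \<bullet> e) * a + snd v * b" for v
  proof -
    have "L v = L ((fst v - (fst v \<bullet> e) *\<^sub>R e, 0) + (fst v \<bullet> e) *\<^sub>R (e, 0) + snd v *\<^sub>R (0, 1))"
      by (rule arg_cong[of _ _ L]) (simp add: prod_eq_iff)
    also have "\<dots> = L (fst v - (fst v \<bullet> e) *\<^sub>R e, 0) + (fst v \<bullet> e) * a + snd v * b"
      by (simp only: linear_add[OF lin] linear_scale[OF lin] a_def b_def real_scaleR_def)
    also have "L (fst v - (fst v \<bullet> e) *\<^sub>R e, 0) = 0"
      by (rule ker, rule sphere_tangent) (use s e in \<open>simp_all add: inner_diff_left ee\<close>)
    finally show ?thesis by simp
  qed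
  have "a \<noteq> 0 \<or> b \<noteq> 0"
    using L(2) by (auto simp: fun_eq_iff L_eq)
  moreover have 1: "deriv x s * a + deriv t s * b = 0"
    using ker[OF meridian_tangent[OF s e]] by (simp add: L_eq ee)
  moreover have 2: "(fst v \<bullet> e) * a + snd v * b = 0"
    using ker[OF v] by (simp add: L_eq)
  have "a * (deriv t s * (fst v \<bullet> e) - deriv x s * snd v) = 0"
    "b * (deriv t s * (fst v \<bullet> e) - deriv x s * snd v) = 0"
    using 1 2 by algebra+
  ultimately show ?thesis
    by auto
qed

text \<open>
  Supplies the test vectors for the orthogonality of $e_n$ to $\xi'$ and the direction in which the
  eigenvalue $k$ is computed.  It holds because $w$ and $iw$ are both orthogonal to $e$ and $ie$.
\<close>

lemma complex_tangentI:
  assumes s: "s \<in> I" and e: "norm e = 1" and w: "w \<bullet> e = 0" "w \<bullet> (\<i> *s e) = 0"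
  shows "(w, 0) \<in> complex_tangent S (point s e)"
proof -
  let ?p = "point s e"
  have H: "(u, 0) \<in> horizontal_tangent S ?p" if "u \<bullet> e = 0" "u \<bullet> (\<i> *s e) = 0" for u
    using that sphere_tangent[OF s e, of u]
    by (simp add: horizontal_tangent_def contact_bundle_def contact_form_inner scale_scaleR
        inner_commute[of _ u])
  have "(w, 0) = cplx_str ?p (- (\<i> *s w), 0)"
    using w by (simp add: cplx_str_eq inner_i_left vec_eq_iff)
  moreover have "(- (\<i> *s w), 0) \<in> horizontal_tangent S ?p"
    using w by (intro H) (simp_all add: inner_i_left inner_i_i)
  ultimately show ?thesis
    using H[OF w] unfolding complex_tangent_def by blast
qed

lemma g_eq: "g s = point s (axis m (cis (\<theta> s)))"
  by (simp add: horizontal_curve_def vec_eq_iff axis_def complex_eq_iff)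

lemma g_derivative:
  assumes s: "s \<in> I"
  shows "(g has_vector_derivative (axis m (\<eta> s * cis (\<theta> s)), deriv t s)) (at s)"
proof -
  have "((\<lambda>r. Complex (x r * cos (\<theta> r)) (x r * sin (\<theta> r)))
      has_vector_derivative \<eta> s * cis (\<theta> s)) (at s)"
    unfolding has_vector_derivative_complex_iff using pos[OF s]
    by (auto intro!: derivative_eq_intros derivatives(1)[OF s] angle[OF s]
        simp: \<eta>_def power2_eq_square field_simps)
  from has_vector_derivative_Pair[OF has_vector_derivative_axis[OF this, of m]
      derivatives(3)[OF s, unfolded has_real_derivative_iff_has_vector_derivative]]
  show ?thesis by (simp add: horizontal_curve_def[abs_def])
qed

lemma arc_length_eq:
  assumes s: "s \<in> I"
  shows "(deriv x s)\<^sup>2 + (deriv t s / x s)\<^sup>2 = 1"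
proof -
  have "axis m (\<eta> s * cis (\<theta> s)) \<bullet> axis m (\<eta> s * cis (\<theta> s)) = 1"
    using arc_length[OF s] vector_derivative_at[OF g_derivative[OF s]]
    by (simp add: levi_metric_def)
  then have "(norm (\<eta> s * cis (\<theta> s)))\<^sup>2 = 1"
    unfolding inner_axis_axis by (simp add: dot_square_norm)
  then show ?thesis
    by (simp add: norm_mult cmod_power2 \<eta>_def)
qed

text \<open>
  Orthogonality to $\xi'$ puts the first entry $z$ of $e_n$ in the real span of $e$ and $ie$;
  horizontality and the tangent equation make it parallel to $\eta e$, and both are unit vectors.
  The sign is prescribed only relative to a unitary matrix carrying the horizontal curve to the
  given point, which is why $A$ occurs here.
\<close>

lemma e_n_eq:
  assumes s: "s \<in> I" and A: "unitary_matrix A" "A *v axis m (cis (\<theta> s)) = e" and e: "norm e = 1"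
  shows "fst (E (point s e)) = \<eta> s *s e"
proof -
  let ?p = "point s e"
  define P Q where "P = deriv x s" and "Q = - deriv t s / x s"
  have \<eta>: "\<eta> s = Complex P Q" by (simp add: \<eta>_def P_def Q_def)
  define z where "z = fst (E ?p)"
  define a b where "a = z \<bullet> e" and "b = z \<bullet> (\<i> *s e)"
  have ee: "e \<bullet> e = 1" using e by (simp add: dot_square_norm)
  have H: "E ?p \<in> horizontal_tangent S ?p" and zz: "z \<bullet> z = 1"
    and orth: "\<And>v. v \<in> complex_tangent S ?p \<Longrightarrow> z \<bullet> fst v = 0"
    using e_n point_in_S[OF s e] by (auto simp: is_e_n_def levi_metric_def z_def)
  define w where "w = z - a *\<^sub>R e - b *\<^sub>R (\<i> *s e)"
  have w: "w \<bullet> e = 0" "w \<bullet> (\<i> *s e) = 0"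
    by (simp_all add: w_def inner_diff_left inner_i_self inner_i_i ee a_def b_def)
  have "z \<bullet> w = 0"
    using orth[OF complex_tangentI[OF s e w]] by simp
  then have "(z - a *\<^sub>R e - b *\<^sub>R (\<i> *s e)) \<bullet> w = 0"
    using w by (simp add: inner_diff_right inner_commute[of _ w])
  then have "w = 0"
    by (simp flip: w_def)
  then have z: "z = a *\<^sub>R e + b *\<^sub>R (\<i> *s e)"
    by (simp add: w_def algebra_simps)
  have "snd (E ?p) = - x s * b"
    using H by (simp add: horizontal_tangent_def contact_bundle_def contact_form_inner b_def z_def
        scale_scaleR inner_commute)
  moreover have "deriv t s * a = P * snd (E ?p)"
    using H tangent_meridian[OF s e] by (simp add: horizontal_tangent_def a_def z_def P_def)
  ultimately have Qa: "Q * a = P * b"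
    using pos[OF s] by (simp add: Q_def field_simps)
  have ab: "a\<^sup>2 + b\<^sup>2 = 1"
    using zz unfolding z
    by (simp add: inner_add inner_i_self inner_i_i ee power2_eq_square)
  have PQ: "P\<^sup>2 + Q\<^sup>2 = 1" using arc_length_eq[OF s] by (simp add: P_def Q_def)
  have "rot A (g s) = ?p"
    using A(2) unfolding g_eq rot_def by (simp add: scaleR_eq_scale vector_scalar_commute)
  moreover have "fst (rot A (vector_derivative g (at s))) = \<eta> s *s e"
    unfolding vector_derivative_at[OF g_derivative[OF s]] rot_def A(2)[symmetric]
    by (simp add: scale_axis flip: vector_scalar_commute)
  ultimately have "z \<bullet> (\<eta> s *s e) > 0"
    using e_n s A(1) unfolding is_e_n_def levi_metric_def z_def by metis
  then have pos: "P * a + Q * b > 0"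
    by (simp add: \<eta> complex_scale_eq[of "Complex P Q"] inner_add_right a_def b_def)
  \<comment> \<open>\<open>q\<close> is the factor of proportionality between \<open>(a, b)\<close> and the unit vector \<open>(P, Q)\<close>.\<close>
  define q where "q = P * a + Q * b"
  have "q * P = a * (P\<^sup>2 + Q\<^sup>2) - Q * (Q * a - P * b)"
    "q * Q = b * (P\<^sup>2 + Q\<^sup>2) + P * (Q * a - P * b)"
    by (simp_all add: q_def power2_eq_square algebra_simps)
  then have q: "q * P = a" "q * Q = b"
    by (simp_all add: Qa PQ)
  have "q\<^sup>2 * (P\<^sup>2 + Q\<^sup>2) = a\<^sup>2 + b\<^sup>2"
    by (simp add: power_mult_distrib algebra_simps flip: q)
  then have "q = 1" using pos by (simp add: q_def[symmetric] ab PQ power2_eq_1_iff)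
  then have "a = P" "b = Q" using q by simp_all
  then show ?thesis
    unfolding z_def[symmetric] z complex_scale_eq[of "\<eta> s"] unfolding \<eta> by simp
qed

lemma norm_axis_cis: "norm (axis m (cis \<phi>) :: complex^'n) = 1"
  by (simp add: norm_eq_1 inner_axis_axis inner_complex_def flip: power2_eq_square)

lemma e_n_along_g:
  assumes s: "s \<in> I"
  shows "fst (E (g s)) = axis m (\<eta> s * cis (\<theta> s))"
proof -
  have "(\<chi> i j. cnj ((mat 1 :: complex^'n^'n) $ j $ i)) = mat 1"
    by (simp add: vec_eq_iff mat_def)
  then have "unitary_matrix (mat 1 :: complex^'n^'n)"
    by (simp add: unitary_matrix_def)
  then show ?thesis
    using e_n_eq[OF s _ matrix_vector_mul_lid norm_axis_cis] by (simp add: g_eq scale_axis)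
qed

text \<open>
  Along the horizontal curve $\alpha e_{2n} + T$ has first entry $\alpha i \eta e$ and vertical
  entry $1 - \alpha x x'$.  The tangent equation becomes
  $\alpha x\,(t'/x)^2 = x' - \alpha x\,(x')^2$, and $|\eta| = 1$ solves it.
\<close>

lemma alpha_eq:
  assumes s: "s \<in> I" and a: "is_alpha S E (g s) a"
  shows "a * x s = deriv x s"
proof -
  let ?e = "axis m (cis (\<theta> s)) :: complex^'n"
  note e = norm_axis_cis[of "\<theta> s"]
  have E: "fst (E (point s ?e)) = \<eta> s *s ?e"
    using e_n_along_g[OF s] by (simp add: g_eq scale_axis)
  have "a *\<^sub>R cplx_str (point s ?e) (E (point s ?e)) + reeb \<in> tangent_space S (point s ?e)"
    using a by (simp add: is_alpha_def e_2n_def g_eq)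
  from tangent_meridian[OF s e this]
  have "deriv t s * (a * (((\<i> * \<eta> s) *s ?e) \<bullet> ?e)) = deriv x s * (1 - a * (x s * ((\<eta> s *s ?e) \<bullet> ?e)))"
    by (simp add: cplx_str_eq reeb_def E vector_smult_assoc)
  then have "deriv t s * (a * (deriv t s / x s)) = deriv x s * (1 - a * (x s * deriv x s))"
    unfolding inner_scale_unit[OF e] by (simp add: \<eta>_def)
  moreover have "deriv t s = x s * (deriv t s / x s)"
    using pos[OF s] by simp
  ultimately show ?thesis
    using arc_length_eq[OF s] by algebra
qed

text \<open>
  Turning $e$ in the direction of the axis $j \ne m$ moves the point with a velocity
  $v \in \xi'$, $v_z = x e^{i\theta}$ on that axis, while $e_{2n} = i\eta e$ turns with it.  The
  eigenvalue equation reads $-i\eta + i\alpha x = kx$, and its left side is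
  $\mathrm{Im}\,\eta$ because $\alpha x = \mathrm{Re}\,\eta$.
\<close>

lemma k_eq:
  assumes s: "s \<in> I" and card: "CARD('n) \<ge> 2" and a: "a * x s = deriv x s"
    and k: "is_common_eigenvalue S E (g s) a k"
  shows "k = - deriv t s / (x s)\<^sup>2"
proof -
  obtain j where j: "j \<noteq> m"
  proof (rule ccontr)
    assume "\<not> thesis"
    then have "UNIV = {m}" using that by blast
    then show False using card by (metis card.empty card.insert empty_iff finite.emptyI
        not_less_eq_eq numeral_2_eq_2 One_nat_def order_refl)
  qed
  define d where "d = cis (\<theta> s)"
  define e :: "real \<Rightarrow> complex^'n" where "e r = axis m (cos r *\<^sub>R d) + axis j (sin r *\<^sub>R d)" for r
  have dd: "d \<bullet> d = 1" by (simp add: dot_square_norm d_def)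
  have "e r \<bullet> e r = (cos r)\<^sup>2 + (sin r)\<^sup>2" for r
    using j by (simp add: e_def inner_add inner_axis_axis dd power2_eq_square)
  then have norm_e: "norm (e r) = 1" for r
    by (simp add: norm_eq_1)
  have e0: "e 0 = axis m d" by (simp add: e_def)
  have E: "fst (E (point s (e r))) = \<eta> s *s e r" for r
  proof -
    obtain A :: "complex^'n^'n" where "unitary_matrix A"
      "\<And>d :: complex. A *v axis m d = axis m (cos r * d) + axis j (sin r * d)"
      using exists_unitary_rotation[of m j r] j by metis
    then show ?thesis
      using norm_e[of r] by (intro e_n_eq[OF s])
        (auto simp: e_def d_def scaleR_conv_of_real[where 'a=complex])
  qed
  let ?p = "point s (e 0)" and ?v = "(axis j (x s * d), 0) :: 'n heis"
  have p: "g s = ?p" by (simp add: g_eq e0 d_def)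
  have "?v \<in> complex_tangent S ?p"
    using j norm_e[of 0] by (intro complex_tangentI[OF s])
      (simp_all add: e0 scale_axis inner_axis_axis)
  then obtain w where w: "has_flat_deriv S (e_2n E) ?p ?v w"
    "- w + a *\<^sub>R cplx_str ?p ?v = k *\<^sub>R ?v"
    using k by (auto simp: is_common_eigenvalue_def p)
  have de: "(e has_vector_derivative axis j d) (at 0)"
  proof -
    have "((\<lambda>r. cos r *\<^sub>R d) has_vector_derivative 0) (at 0)"
      "((\<lambda>r. sin r *\<^sub>R d) has_vector_derivative d) (at 0)"
      unfolding has_vector_derivative_complex_iff by (auto intro!: derivative_eq_intros)
    from has_vector_derivative_add[OF this(1)[THEN has_vector_derivative_axis, of m]
        this(2)[THEN has_vector_derivative_axis, of j]]
    show ?thesis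
      by (simp add: e_def[abs_def] linear_0[OF bounded_linear.linear[OF bounded_linear_axis]])
  qed
  have "((\<lambda>r. point s (e r)) has_vector_derivative (x s *\<^sub>R axis j d, 0)) (at 0)"
    using de unfolding has_vector_derivative_def
    by (auto intro!: derivative_eq_intros simp: fun_eq_iff)
  moreover have "x s *\<^sub>R axis j d = axis j (x s * d)"
    by (auto simp: axis_def vec_eq_iff scaleR_conv_of_real[where 'a=complex])
  ultimately have dc: "((\<lambda>r. point s (e r)) has_vector_derivative ?v) (at 0)" by simp
  have lin: "bounded_linear (\<lambda>v :: complex^'n. c *s v)" for c
    unfolding linear_conv_bounded_linear[symmetric]
    by (intro linearI) (simp_all add: vector_add_ldistrib scale_scaleR)
  have "((\<lambda>r. to_frame (point s (e r)) (e_2n E (point s (e r))))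
      has_vector_derivative ((\<i> * \<eta> s) *s axis j d, 0)) (at 0)"
    unfolding e_2n_def to_frame_cplx_str E vector_smult_assoc
    by (intro has_vector_derivative_Pair has_vector_derivative_const
        bounded_linear.has_vector_derivative[OF lin] de)
  moreover have "range (\<lambda>r. point s (e r)) \<subseteq> S"
    using s norm_e by (auto intro: point_in_S)
  ultimately have "fst w = axis j (\<i> * \<eta> s * d)"
    using has_flat_deriv_along_curve[OF w(1) open_UNIV UNIV_I _ refl dc]
    by (simp add: scale_axis)
  then have "- (\<i> * \<eta> s * d) + a * (\<i> * (x s * d)) = k * (x s * d)"
    using arg_cong[OF w(2), of "\<lambda>v. fst v $ j"]
    by (simp add: cplx_str_eq scaleR_conv_of_real[where 'a=complex])
  then have "d * (- (\<i> * \<eta> s) + \<i> * complex_of_real (a * x s)) = d * (complex_of_real (k * x s))"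
    by (simp add: algebra_simps)
  then have "- (\<i> * \<eta> s) + \<i> * complex_of_real (a * x s) = complex_of_real (k * x s)"
    by (simp add: d_def)
  then have "- deriv t s / x s = k * x s"
    by (simp add: complex_eq_iff \<eta>_def)
  then show ?thesis
    using pos[OF s] by (simp add: field_simps power2_eq_square)
qed

text \<open>
  The frame components of $e_{2n}$ along the horizontal curve are $i \eta e^{i\theta}$, whose
  derivative is $i(\eta' + i\theta'\eta) e^{i\theta}$.  Dividing its negative by
  $\eta e^{i\theta}$, with $\eta^{-1} = \bar\eta$, gives $l$.
\<close>

lemma l_eq:
  assumes s: "s \<in> I" and l: "is_l S E (g s) l" and d\<eta>: "(\<eta> has_vector_derivative \<eta>') (at s)"
  shows "l = - deriv t s / (x s)\<^sup>2 + Im (cnj (\<eta> s) * \<eta>')"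
proof -
  obtain w where w: "has_flat_deriv S (e_2n E) (g s) (E (g s)) w" "- w = l *\<^sub>R E (g s)"
    using l by (auto simp: is_l_def)
  define q where "q = - deriv t s / (x s)\<^sup>2"
  define d where "d = \<i> * (\<eta>' + \<i> * q * \<eta> s) * cis (\<theta> s)"
  \<comment> \<open>The chain rule asks for a curve with velocity \<open>E (g s)\<close>: the horizontal curve itself.\<close>
  have E_g: "E (g s) = (axis m (\<eta> s * cis (\<theta> s)), deriv t s)"
  proof -
    let ?e = "axis m (cis (\<theta> s)) :: complex^'n"
    note e = norm_axis_cis[of "\<theta> s"]
    have "E (g s) \<in> contact_bundle (g s)"
      using e_n point_in_S[OF s e] by (simp add: g_eq is_e_n_def horizontal_tangent_def)
    moreover have E: "fst (E (g s)) = \<eta> s *s ?e"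
      by (simp add: e_n_along_g[OF s] scale_axis)
    ultimately have "snd (E (g s)) = - (x s * ((\<i> *s ?e) \<bullet> (\<eta> s *s ?e)))"
      unfolding contact_bundle_def contact_form_inner by (simp add: g_eq scale_scaleR)
    also have "(\<i> *s ?e) \<bullet> (\<eta> s *s ?e) = Im (\<eta> s)"
      using e unfolding complex_scale_eq[of "\<eta> s"]
      by (simp add: inner_add_right inner_i_self inner_i_i norm_eq_1)
    finally have "snd (E (g s)) = deriv t s"
      using pos[OF s] by (simp add: \<eta>_def)
    then show ?thesis by (simp add: prod_eq_iff e_n_along_g[OF s])
  qed
  have "((\<lambda>r. \<i> * (\<eta> r * cis (\<theta> r))) has_vector_derivative d) (at s)"
    using d\<eta> angle[OF s] unfolding has_vector_derivative_def has_field_derivative_def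
    by (auto intro!: derivative_eq_intros
        simp: fun_eq_iff d_def q_def scaleR_conv_of_real[where 'a=complex] algebra_simps)
  then have "((\<lambda>r. (axis m (\<i> * (\<eta> r * cis (\<theta> r))), 0) :: 'n heis)
      has_vector_derivative (axis m d, 0)) (at s)"
    by (intro has_vector_derivative_Pair has_vector_derivative_axis has_vector_derivative_const)
  then have "((\<lambda>r. to_frame (g r) (e_2n E (g r))) has_vector_derivative (axis m d, 0)) (at s)"
    by (rule has_vector_derivative_transform_within_open[OF _ open_I s])
       (simp add: e_2n_def to_frame_cplx_str e_n_along_g scale_axis)
  moreover have "g ` I \<subseteq> S"
    by (auto simp: g_eq norm_axis_cis intro!: point_in_S)
  ultimately have "fst w = axis m d"
    using has_flat_deriv_along_curve[of S "e_2n E" "g s" "E (g s)" w I s g "(axis m d, 0)"]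
      w(1) open_I s g_derivative[OF s] E_g by simp
  then have "- d = l * (\<eta> s * cis (\<theta> s))"
    using arg_cong[OF w(2), of "\<lambda>v. fst v $ m"]
    by (simp add: E_g scaleR_conv_of_real[where 'a=complex])
  then have "cis (\<theta> s) * (- \<i> * \<eta>' + q * \<eta> s) = cis (\<theta> s) * (l * \<eta> s)"
    by (simp add: d_def algebra_simps)
  then have "- \<i> * \<eta>' + q * \<eta> s = l * \<eta> s"
    by simp
  then have "Re (cnj (\<eta> s) * (- \<i> * \<eta>' + q * \<eta> s)) = Re (cnj (\<eta> s) * (l * \<eta> s))"
    by simp
  moreover have "(Re (\<eta> s))\<^sup>2 + (Im (\<eta> s))\<^sup>2 = 1"
    using arc_length_eq[OF s] by (simp add: \<eta>_def)
  ultimately have "l = q + Im (cnj (\<eta> s) * \<eta>')"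
    by simp algebra
  then show ?thesis by (simp add: q_def)
qed

end

theorem proposition3p3:
  fixes S :: "'n::finite heis set" and m :: 'n and I :: "real set"
    and x t \<theta> \<alpha> k l :: "real \<Rightarrow> real"
    and g :: "real \<Rightarrow> 'n heis" and E :: "'n heis \<Rightarrow> 'n heis"
  assumes I: "open I" "connected I"
    and curve: "regular_curve I x t" "\<forall>s\<in>I. x s > 0"
    and surface: "S = generated_set I x t" "smooth_hypersurface S" "rotationally_symmetric S"
    and angle: "\<forall>s\<in>I. (\<theta> has_real_derivative - deriv t s / (x s)\<^sup>2) (at s)"
    and g: "g = horizontal_curve m x \<theta> t"
    and arc_length: "\<forall>s\<in>I. levi_metric (vector_derivative g (at s)) (vector_derivative g (at s)) = 1"
    and E: "is_e_n S I g E"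
    and alpha: "\<forall>s\<in>I. is_alpha S E (g s) (\<alpha> s)"
    and l: "\<forall>s\<in>I. is_l S E (g s) (l s)"
    and k_ge2: "CARD('n) \<ge> 2 \<Longrightarrow> \<forall>s\<in>I. is_common_eigenvalue S E (g s) (\<alpha> s) (k s)"
    and k_1: "CARD('n) = 1 \<Longrightarrow>
      \<forall>s\<in>I. k s = - deriv t s / (x s * sqrt ((x s * deriv x s)\<^sup>2 + (deriv t s)\<^sup>2))"
  shows "\<forall>s\<in>I.
      (x has_real_derivative \<alpha> s * x s) (at s) \<and>
      (t has_real_derivative - k s * (x s)\<^sup>2) (at s) \<and>
      (\<theta> has_real_derivative k s) (at s) \<and>
      \<alpha> differentiable (at s) \<and> k differentiable (at s) \<and>
      l s = k s + (\<alpha> s * deriv k s - k s * deriv \<alpha> s) * (x s)\<^sup>2"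
proof
  interpret R: rotational_hypersurface S I x t \<theta> m E
    using assms by unfold_locales auto
  have pos: "x s > 0" if "s \<in> I" for s using curve(2) that by blast
  have \<alpha>: "\<alpha> r * x r = deriv x r" if "r \<in> I" for r
    using R.alpha_eq[of r "\<alpha> r"] alpha that g by blast
  have k: "k r = - deriv t r / (x r)\<^sup>2" if r: "r \<in> I" for r
  proof (cases "CARD('n) \<ge> 2")
    case True
    then show ?thesis using R.k_eq[OF r True \<alpha>[OF r]] k_ge2 r g by blast
  next
    case False
    then have "CARD('n) = 1"
      using zero_less_card_finite[where 'a='n] by linarith
    \<comment> \<open>In arc-length parametrization the square root in the formula for \<open>n = 1\<close> equals \<open>x\<close>.\<close>
    moreover have "(x r * deriv x r)\<^sup>2 + (deriv t r)\<^sup>2 = (x r)\<^sup>2 * ((deriv x r)\<^sup>2 + (deriv t r / x r)\<^sup>2)"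
      using pos[OF r] by (simp add: field_simps)
    then have "sqrt ((x r * deriv x r)\<^sup>2 + (deriv t r)\<^sup>2) = x r"
      using pos[OF r] by (simp add: R.arc_length_eq[OF r])
    ultimately show ?thesis
      using k_1 r by (simp add: power2_eq_square)
  qed
  fix s assume s: "s \<in> I"
  note d = R.derivatives[OF s] and x0 = pos[OF s]
  have "((\<lambda>r. deriv x r / x r) has_real_derivative
      (deriv (deriv x) s * x s - deriv x s * deriv x s) / (x s * x s)) (at s)"
    using x0 by (auto intro!: derivative_eq_intros d)
  then have d\<alpha>: "(\<alpha> has_real_derivative
      (deriv (deriv x) s * x s - deriv x s * deriv x s) / (x s * x s)) (at s)"
  proof (rule has_field_derivative_transform_within_open[OF _ I(1) s])
    show "deriv x r / x r = \<alpha> r" if "r \<in> I" for r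
      using pos[OF that] by (simp flip: \<alpha>[OF that])
  qed
  have "((\<lambda>r. - deriv t r / (x r)\<^sup>2) has_real_derivative
      (- deriv (deriv t) s * (x s)\<^sup>2 + deriv t s * (2 * x s * deriv x s)) / ((x s)\<^sup>2 * (x s)\<^sup>2)) (at s)"
    using x0 by (auto intro!: derivative_eq_intros d simp: diff_divide_distrib algebra_simps)
  then have dk: "(k has_real_derivative
      (- deriv (deriv t) s * (x s)\<^sup>2 + deriv t s * (2 * x s * deriv x s)) / ((x s)\<^sup>2 * (x s)\<^sup>2)) (at s)"
    by (rule has_field_derivative_transform_within_open[OF _ I(1) s]) (simp add: k)
  have d\<eta>: "(R.\<eta> has_vector_derivative Complex (deriv \<alpha> s * x s + \<alpha> s * deriv x s)
      (deriv k s * x s + k s * deriv x s)) (at s)"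
  proof (rule has_vector_derivative_transform_within_open[OF _ I(1) s])
    show "((\<lambda>r. Complex (\<alpha> r * x r) (k r * x r)) has_vector_derivative
      Complex (deriv \<alpha> s * x s + \<alpha> s * deriv x s) (deriv k s * x s + k s * deriv x s)) (at s)"
      unfolding has_vector_derivative_complex_iff DERIV_imp_deriv[OF d\<alpha>] DERIV_imp_deriv[OF dk]
      by (auto intro!: derivative_eq_intros d d\<alpha> dk)
    show "Complex (\<alpha> r * x r) (k r * x r) = R.\<eta> r" if "r \<in> I" for r
      using pos[OF that] by (simp add: R.\<eta>_def \<alpha>[OF that] k[OF that] power2_eq_square)
  qed
  have "R.\<eta> s = Complex (\<alpha> s * x s) (k s * x s)"
    using x0 by (simp add: R.\<eta>_def \<alpha>[OF s] k[OF s] power2_eq_square)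
  moreover have "l s = k s + Im (cnj (R.\<eta> s) * Complex (deriv \<alpha> s * x s + \<alpha> s * deriv x s)
      (deriv k s * x s + k s * deriv x s))"
    using R.l_eq[OF s _ d\<eta>, of "l s"] l s g k[OF s] by simp
  ultimately have "l s = k s + (\<alpha> s * deriv k s - k s * deriv \<alpha> s) * (x s)\<^sup>2"
    by (simp add: power2_eq_square algebra_simps)
  moreover have "(x has_real_derivative \<alpha> s * x s) (at s)"
    using d(1) \<alpha>[OF s] by simp
  moreover have "(t has_real_derivative - k s * (x s)\<^sup>2) (at s)"
    using d(3) k[OF s] x0 by simp
  moreover have "(\<theta> has_real_derivative k s) (at s)"
    using angle s k[OF s] by simp
  moreover have "\<alpha> differentiable (at s)" "k differentiable (at s)"
    using d\<alpha> dk by (auto simp: real_differentiable_def)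
  ultimately show "(x has_real_derivative \<alpha> s * x s) (at s) \<and>
      (t has_real_derivative - k s * (x s)\<^sup>2) (at s) \<and>
      (\<theta> has_real_derivative k s) (at s) \<and>
      \<alpha> differentiable (at s) \<and> k differentiable (at s) \<and>
      l s = k s + (\<alpha> s * deriv k s - k s * deriv \<alpha> s) * (x s)\<^sup>2"
    by blast
qed

end
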